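(* There is a polynomial-time $(2\ln\frac{m}{2})$-approximation algorithm for the minimum representation subset problem on instances $(W,s)$ with $s\notin\{\mathbf{0},\mathbf{1}\}$: given a finite set $W\subseteq\{0,1\}^m$ of binary strings of length $m$ and a string $s\in\{0,1\}^m$ with $s\notin\{\mathbf{0},\mathbf{1}\}$ that is representable by $W$, it outputs a subset $C\subseteq W$ such that $s$ is representable by $C$ and $|C|$ is at most $2\ln\frac{m}{2}$ times the minimum cardinality of a subset of $W$ by which $s$ is representable.
   Context: $\mathbf{0}$ and $\mathbf{1}$ denote the all-zero and the all-one string of length $m$. For strings $x,y\in\{0,1\}^m$, $x\wedge y$ and $x\vee y$ denote bitwise AND and bitwise OR. A string $s$ is representable by a set $C$ of strings if there is a formula with operators in $\{\wedge,\vee\}$ (no negation) and operands in $C$ which evaluates to $s$. The minimum representation subset problem asks, given $(W,s)$ with $s$ representable by $W$, for a subset of $W$ of minimum cardinality by which $s$ is representable.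
   Formalization: The ratio is max(1, 2 ln(m/2)) instead of 2 ln(m/2): unchanged for m ≥ 4, but for m = 2 and m = 3, where 2 ln(m/2) < 1 and no algorithm can meet it (e.g. W = {s}), an optimal solution is required instead. *)

theory Defs
  imports Complex_Main "HOL-Computational_Algebra.Polynomial"
begin

section \<open>Representability of strings\<close>

datatype (operands: 'a) formula =
    Operand 'a
  | And "'a formula" "'a formula"
  | Or "'a formula" "'a formula"

text \<open>Strings over \<open>{0,1}\<close> are lists of Booleans. Since \<open>map2\<close> truncates, \<open>eval\<close> is only
  meaningful when all operands have the same length.\<close>

fun eval :: "bool list formula \<Rightarrow> bool list" where
  "eval (Operand x) = x"
| "eval (And f g) = map2 (\<and>) (eval f) (eval g)"
| "eval (Or f g) = map2 (\<or>) (eval f) (eval g)"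

definition representable :: "bool list set \<Rightarrow> bool list \<Rightarrow> bool" where
  "representable C s \<longleftrightarrow> (\<exists>f. operands f \<subseteq> C \<and> eval f = s)"

definition mrs_instance :: "nat \<Rightarrow> bool list set \<Rightarrow> bool list \<Rightarrow> bool" where
  "mrs_instance m W s \<longleftrightarrow>
     finite W \<and> (\<forall>w\<in>W. length w = m) \<and> length s = m \<and> representable W s"

definition mrs_opt :: "bool list set \<Rightarrow> bool list \<Rightarrow> nat" where
  "mrs_opt W s = Min (card ` {C. C \<subseteq> W \<and> representable C s})"


section \<open>Random access machines\<close>

text \<open>A structured RAM with registers and an unbounded memory, both holding natural numbers and
  indexed by natural numbers. The only arithmetic is addition and truncated subtraction. As there
  is no multiplication, the bit length of the stored numbers grows by at most one per step, so
  that polynomial time under this unit-cost measure agrees with polynomial time on Turing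
  machines.\<close>

datatype com =
    Skip
  | Const nat nat
  | Copy nat nat
  | Add nat nat nat
  | Sub nat nat nat
  | Load nat nat
  | Store nat nat
  | Seq com com
  | Cond nat com com
  | While nat com

type_synonym state = "(nat \<Rightarrow> nat) \<times> (nat \<Rightarrow> nat)"

text \<open>\<open>exec c \<sigma> t \<sigma>'\<close>: started in \<open>\<sigma>\<close>, program \<open>c\<close> halts in \<open>\<sigma>'\<close> after exactly \<open>t\<close> steps. States
  are pairs of register contents \<open>r\<close> and memory contents \<open>M\<close>. \<open>Load i j\<close> is
  \<open>r\<^sub>i := M[r\<^sub>j]\<close> and \<open>Store i j\<close> is \<open>M[r\<^sub>i] := r\<^sub>j\<close>; a register counts as true iff it is nonzero.\<close>

inductive exec :: "com \<Rightarrow> state \<Rightarrow> nat \<Rightarrow> state \<Rightarrow> bool" where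
  Skip: "exec Skip \<sigma> 1 \<sigma>"
| Const: "exec (Const i k) (r, M) 1 (r(i := k), M)"
| Copy: "exec (Copy i j) (r, M) 1 (r(i := r j), M)"
| Add: "exec (Add i j k) (r, M) 1 (r(i := r j + r k), M)"
| Sub: "exec (Sub i j k) (r, M) 1 (r(i := r j - r k), M)"
| Load: "exec (Load i j) (r, M) 1 (r(i := M (r j)), M)"
| Store: "exec (Store i j) (r, M) 1 (r, M(r i := r j))"
| Seq: "exec c \<sigma> t \<sigma>' \<Longrightarrow> exec d \<sigma>' u \<sigma>'' \<Longrightarrow> exec (Seq c d) \<sigma> (t + u) \<sigma>''"
| CondTrue: "fst \<sigma> i \<noteq> 0 \<Longrightarrow> exec c \<sigma> t \<sigma>' \<Longrightarrow> exec (Cond i c d) \<sigma> (t + 1) \<sigma>'"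
| CondFalse: "fst \<sigma> i = 0 \<Longrightarrow> exec d \<sigma> t \<sigma>' \<Longrightarrow> exec (Cond i c d) \<sigma> (t + 1) \<sigma>'"
| WhileFalse: "fst \<sigma> i = 0 \<Longrightarrow> exec (While i c) \<sigma> 1 \<sigma>"
| WhileTrue: "fst \<sigma> i \<noteq> 0 \<Longrightarrow> exec c \<sigma> t \<sigma>' \<Longrightarrow> exec (While i c) \<sigma>' u \<sigma>''
    \<Longrightarrow> exec (While i c) \<sigma> (t + u + 1) \<sigma>''"

inductive_cases exec_SkipE: "exec Skip \<sigma> t \<sigma>'"
inductive_cases exec_ConstE: "exec (Const i k) \<sigma> t \<sigma>'"
inductive_cases exec_CopyE: "exec (Copy i j) \<sigma> t \<sigma>'"
inductive_cases exec_AddE: "exec (Add i j k) \<sigma> t \<sigma>'"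
inductive_cases exec_SubE: "exec (Sub i j k) \<sigma> t \<sigma>'"
inductive_cases exec_LoadE: "exec (Load i j) \<sigma> t \<sigma>'"
inductive_cases exec_StoreE: "exec (Store i j) \<sigma> t \<sigma>'"
inductive_cases exec_SeqE: "exec (Seq c d) \<sigma> t \<sigma>'"
inductive_cases exec_CondE: "exec (Cond i c d) \<sigma> t \<sigma>'"
inductive_cases exec_WhileE: "exec (While i c) \<sigma> t \<sigma>'"

lemma exec_deterministic:
  "exec c \<sigma> t \<sigma>' \<Longrightarrow> exec c \<sigma> u \<sigma>'' \<Longrightarrow> u = t \<and> \<sigma>'' = \<sigma>'"
proof (induction arbitrary: u \<sigma>'' rule: exec.induct)
  case Skip then show ?case by (auto elim: exec_SkipE)
next
  case Const then show ?case by (auto elim: exec_ConstE)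
next
  case Copy then show ?case by (auto elim: exec_CopyE)
next
  case Add then show ?case by (auto elim: exec_AddE)
next
  case Sub then show ?case by (auto elim: exec_SubE)
next
  case Load then show ?case by (auto elim: exec_LoadE)
next
  case Store then show ?case by (auto elim: exec_StoreE)
next
  case Seq
  from Seq.prems show ?case by (rule exec_SeqE) (use Seq.IH in blast)
next
  case (CondTrue \<sigma> i c t \<sigma>' d)
  from CondTrue.prems obtain v where "exec c \<sigma> v \<sigma>''" and "u = v + 1"
    by (rule exec_CondE) (use CondTrue.hyps in simp_all)
  moreover from this(1) have "v = t \<and> \<sigma>'' = \<sigma>'" by (rule CondTrue.IH)
  ultimately show ?case by simp
next
  case (CondFalse \<sigma> i d t \<sigma>' c)
  from CondFalse.prems obtain v where "exec d \<sigma> v \<sigma>''" and "u = v + 1"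
    by (rule exec_CondE) (use CondFalse.hyps in simp_all)
  moreover from this(1) have "v = t \<and> \<sigma>'' = \<sigma>'" by (rule CondFalse.IH)
  ultimately show ?case by simp
next
  case WhileFalse
  from WhileFalse.prems show ?case
    by (rule exec_WhileE) (use WhileFalse.hyps in simp_all)
next
  case (WhileTrue \<sigma> i c t \<sigma>' w \<tau>)
  from WhileTrue.prems obtain v \<rho> v'
    where c: "exec c \<sigma> v \<rho>" and l: "exec (While i c) \<rho> v' \<sigma>''" and u: "u = v + v' + 1"
    by (rule exec_WhileE) (use WhileTrue.hyps in simp_all)
  from c have v: "v = t \<and> \<rho> = \<sigma>'" by (rule WhileTrue.IH(1))
  with l have "exec (While i c) \<sigma>' v' \<sigma>''" by simp
  then have "v' = w \<and> \<sigma>'' = \<tau>" by (rule WhileTrue.IH(2))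
  with u v show ?case by simp
qed

text \<open>Input and output words occupy the memory cells \<open>0, 1, 2, \<dots>\<close>, with their length in register
  0; all other cells and registers are initially 0.\<close>

definition input_state :: "nat list \<Rightarrow> state" where
  "input_state x =
     ((\<lambda>_. 0)(0 := length x), (\<lambda>a. if a < length x then x ! a else 0))"

definition output_word :: "state \<Rightarrow> nat list" where
  "output_word \<sigma> = map (snd \<sigma>) [0..<fst \<sigma> 0]"

definition outputs_in :: "com \<Rightarrow> nat list \<Rightarrow> nat \<Rightarrow> nat list \<Rightarrow> bool" where
  "outputs_in A x t y \<longleftrightarrow> (\<exists>\<sigma>. exec A (input_state x) t \<sigma> \<and> output_word \<sigma> = y)"


section \<open>Encoding of instances and solutions\<close>

text \<open>A list of strings becomes a word over the alphabet \<open>{0,1,2}\<close>, each string being terminated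
  by the separator 2. The length of this word is the input size.\<close>

definition encode :: "bool list list \<Rightarrow> nat list" where
  "encode xs = concat (map (\<lambda>x. map of_bool x @ [2]) xs)"

lemma encode_terminated_inj:
  "map of_bool x @ (2::nat) # u = map of_bool y @ 2 # v \<Longrightarrow> x = y \<and> u = v"
proof (induction x arbitrary: y)
  case Nil
  then show ?case by (cases y) (auto simp: of_bool_def split: if_splits)
next
  case (Cons a x)
  obtain b y' where y: "y = b # y'"
    using Cons.prems by (cases y) (auto simp: of_bool_def split: if_splits)
  have "map of_bool x @ (2::nat) # u = map of_bool y' @ 2 # v"
    using Cons.prems y by simp
  then have "x = y' \<and> u = v" by (rule Cons.IH)
  moreover have "a = b"
    using Cons.prems y by (simp add: of_bool_def split: if_splits)
  ultimately show ?case using y by simp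
qed

lemma encode_inj: "encode xs = encode ys \<Longrightarrow> xs = ys"
proof (induction xs arbitrary: ys)
  case Nil
  then show ?case by (cases ys) (auto simp: encode_def)
next
  case (Cons x xs)
  obtain y ys' where ys: "ys = y # ys'"
    using Cons.prems by (cases ys) (auto simp: encode_def)
  have "map of_bool x @ (2::nat) # encode xs = map of_bool y @ 2 # encode ys'"
    using Cons.prems by (simp add: ys encode_def)
  then have "x = y" and "encode xs = encode ys'"
    by (blast dest: encode_terminated_inj)+
  from this(2) have "xs = ys'" by (rule Cons.IH)
  with \<open>x = y\<close> ys show ?case by simp
qed

text \<open>A finite set is presented to and returned by a machine as a repetition-free list of its
  elements, in any order.\<close>

definition enumerates :: "'a list \<Rightarrow> 'a set \<Rightarrow> bool" where
  "enumerates xs X \<longleftrightarrow> distinct xs \<and> set xs = X"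

text \<open>No algorithm has a ratio below 1, whereas \<open>2 ln (m/2) < 1\<close> for \<open>m = 2, 3\<close> (there \<open>W = {s}\<close>
  would need a solution with no string). For \<open>m \<ge> 4\<close> the maximum is \<open>2 ln (m/2)\<close>; for \<open>m < 4\<close> it
  demands an optimal solution.\<close>

definition mrs_ratio :: "nat \<Rightarrow> real" where
  "mrs_ratio m = max 1 (2 * ln (real m / 2))"

end

(* s is representable by C iff every pair (i, j) with s_i = 1 and s_j = 0 is separated by some w in C,
   that is w_i = 1 and w_j = 0. So the problem is set cover over n <= (m/2)^2 pairs. Greedy with optimum
   k uses at most k (1 + ln (n/k)) sets, which is at most k ln n = 2 k ln (m/2) as soon as k >= 3 (> e).
   The cases k = 1 and k = 2, where the additive constant would spoil the ratio, are settled by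
   exhaustive search. *)

theory Submission
  imports Defs
begin

text \<open>Separation is the right notion because operators without negation preserve every
  implication from bit i to bit j that all operands satisfy; the converse is a disjunctive normal
  form. That form needs nonempty conjunctions and disjunctions, as formulas have no constants, and
  this is where the all-zero and all-one strings drop out: their set of pairs is empty, but the
  empty set represents nothing. The constant m/2 is the inequality p (m - p) \<le> (m/2)^2 for p
  ones, and its square gives the factor 2. The demand for a concrete machine shapes the rest. Loops
  have fixed nesting and each iterates at most as often as the input is long, so the polynomial is
  read off the program and no steps are counted. As the machine cannot multiply, rows are named by
  their addresses and loops advance by the row length.\<close>

section \<open>Weakest preconditions with implicit time bounds\<close>

text \<open>A time bound can be read off the program text as soon as every loop iterates at most \<open>n\<close> times.\<close>

primrec time_poly :: "com \<Rightarrow> nat poly" where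
  "time_poly Skip = 1"
| "time_poly (Const i k) = 1"
| "time_poly (Copy i j) = 1"
| "time_poly (Add i j k) = 1"
| "time_poly (Sub i j k) = 1"
| "time_poly (Load i j) = 1"
| "time_poly (Store i j) = 1"
| "time_poly (Seq c d) = time_poly c + time_poly d"
| "time_poly (Cond i c d) = time_poly c + time_poly d + 1"
| "time_poly (While i c) = [:0, 1:] * (time_poly c + 1) + 1"

text \<open>Halting, step bound and postcondition are bundled so that the composition rules need no
  bookkeeping of time. One \<open>n\<close> bounds the iterations of all loops, however deeply
  nested.\<close>

definition wp :: "nat \<Rightarrow> com \<Rightarrow> (state \<Rightarrow> bool) \<Rightarrow> state \<Rightarrow> bool" where
  "wp n c Q \<sigma> \<longleftrightarrow> (\<exists>t \<sigma>'. exec c \<sigma> t \<sigma>' \<and> t \<le> poly (time_poly c) n \<and> Q \<sigma>')"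

lemma wp_mono: "wp n c Q \<sigma> \<Longrightarrow> (\<And>\<sigma>'. Q \<sigma>' \<Longrightarrow> Q' \<sigma>') \<Longrightarrow> wp n c Q' \<sigma>"
  unfolding wp_def by blast

lemma wp_atomic:
  "Q \<sigma> \<Longrightarrow> wp n Skip Q \<sigma>"
  "Q (r(i := k), M) \<Longrightarrow> wp n (Const i k) Q (r, M)"
  "Q (r(i := r j), M) \<Longrightarrow> wp n (Copy i j) Q (r, M)"
  "Q (r(i := r j + r k), M) \<Longrightarrow> wp n (Add i j k) Q (r, M)"
  "Q (r(i := r j - r k), M) \<Longrightarrow> wp n (Sub i j k) Q (r, M)"
  "Q (r(i := M (r j)), M) \<Longrightarrow> wp n (Load i j) Q (r, M)"
  "Q (r, M(r i := r j)) \<Longrightarrow> wp n (Store i j) Q (r, M)"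
  unfolding wp_def by (fastforce intro: exec.intros)+

lemma wp_Seq: "wp n c (wp n d Q) \<sigma> \<Longrightarrow> wp n (Seq c d) Q \<sigma>"
  unfolding wp_def by (fastforce intro: exec.Seq add_mono)

lemma wp_Cond:
  assumes "fst \<sigma> i \<noteq> 0 \<Longrightarrow> wp n c Q \<sigma>" and "fst \<sigma> i = 0 \<Longrightarrow> wp n d Q \<sigma>"
  shows "wp n (Cond i c d) Q \<sigma>"
proof (cases "fst \<sigma> i = 0")
  case True
  with assms(2) show ?thesis unfolding wp_def
    by (fastforce intro: exec.CondFalse)
next
  case False
  with assms(1) show ?thesis unfolding wp_def
    by (fastforce intro: exec.CondTrue)
qed

lemma wp_While:
  assumes inv: "I \<sigma>" and var: "V \<sigma> \<le> n"
    and body: "\<And>\<sigma>. I \<sigma> \<Longrightarrow> fst \<sigma> i \<noteq> 0 \<Longrightarrow> wp n c (\<lambda>\<sigma>'. I \<sigma>' \<and> V \<sigma>' < V \<sigma>) \<sigma>"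
    and exit: "\<And>\<sigma>. I \<sigma> \<Longrightarrow> fst \<sigma> i = 0 \<Longrightarrow> Q \<sigma>"
  shows "wp n (While i c) Q \<sigma>"
proof -
  let ?T = "poly (time_poly c) n + 1"
  have "\<exists>t \<sigma>'. exec (While i c) \<sigma> t \<sigma>' \<and> t \<le> V \<sigma> * ?T + 1 \<and> Q \<sigma>'"
    using inv
  proof (induction "V \<sigma>" arbitrary: \<sigma> rule: less_induct)
    case less
    show ?case
    proof (cases "fst \<sigma> i = 0")
      case True
      then show ?thesis using exit[OF less.prems] by (fastforce intro: exec.WhileFalse)
    next
      case False
      from body[OF less.prems False] obtain t \<sigma>' where c: "exec c \<sigma> t \<sigma>'"
        and t: "t \<le> poly (time_poly c) n" and I: "I \<sigma>'" and V: "V \<sigma>' < V \<sigma>"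
        unfolding wp_def by blast
      from less.hyps[OF V I] obtain u \<sigma>'' where d: "exec (While i c) \<sigma>' u \<sigma>''"
        and u: "u \<le> V \<sigma>' * ?T + 1" and Q: "Q \<sigma>''" by blast
      have "t + u + 1 \<le> ?T + (V \<sigma>' * ?T + 1)" using t u by simp
      also have "\<dots> = Suc (V \<sigma>') * ?T + 1" by simp
      also have "\<dots> \<le> V \<sigma> * ?T + 1" using V by (intro add_mono mult_le_mono1) auto
      finally show ?thesis using exec.WhileTrue[OF False c d] Q by blast
    qed
  qed
  then obtain t \<sigma>' where "exec (While i c) \<sigma> t \<sigma>'" "t \<le> V \<sigma> * ?T + 1" "Q \<sigma>'" by blast
  moreover have "V \<sigma> * ?T + 1 \<le> n * ?T + 1" using var by (intro add_mono mult_le_mono1) auto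
  ultimately show ?thesis unfolding wp_def by (fastforce intro: order.trans)
qed

abbreviation seq (infixr ";;" 60) where "c ;; d \<equiv> Seq c d"

text \<open>Register 4 is reserved for loop conditions; nested loops may share it because it is
  recomputed right before every test.\<close>

definition For :: "nat \<Rightarrow> nat \<Rightarrow> nat \<Rightarrow> com \<Rightarrow> com" where
  "For i b d c = (Sub 4 b i ;; While 4 (c ;; Add i i d ;; Sub 4 b i))"

lemma wp_For:
  assumes init: "\<And>v. I k (r(4 := v), M)" and k: "k \<le> K" "K - k \<le> n"
    and cond: "\<And>k r M. I k (r, M) \<Longrightarrow> k \<le> K \<Longrightarrow> r i < r b \<longleftrightarrow> k < K"
    and i: "i \<noteq> 4" "b \<noteq> 4"
    and body: "\<And>k r M. I k (r, M) \<Longrightarrow> k < K \<Longrightarrow>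
      wp n c (\<lambda>(r, M). \<forall>v. I (Suc k) (r(i := r i + r d, 4 := v), M)) (r, M)"
    and exit: "\<And>r M. I K (r, M) \<Longrightarrow> Q (r, M)"
  shows "wp n (For i b d c) Q (r, M)"
proof -
  have key: "\<exists>t \<sigma>'. exec (While 4 (c ;; Add i i d ;; Sub 4 b i)) (r, M) t \<sigma>' \<and>
      t \<le> (K - k) * (poly (time_poly c) n + 3) + 1 \<and> Q \<sigma>'"
    if "I k (r, M)" "k \<le> K" "r 4 = r b - r i" for k r M
    using that
  proof (induction "K - k" arbitrary: k r M)
    case 0
    then have "k = K" by simp
    with 0 cond[of k r M] have "r 4 = 0" by simp
    with 0 \<open>k = K\<close> exit show ?case by (fastforce intro: exec.WhileFalse)
  next
    case (Suc x)
    then have kK: "k < K" by simp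
    with Suc cond[of k r M] have nz: "fst (r, M) 4 \<noteq> 0" by simp
    from body[OF Suc.prems(1) kK] obtain t r' M' where c: "exec c (r, M) t (r', M')"
      and t: "t \<le> poly (time_poly c) n" and I: "\<And>v. I (Suc k) (r'(i := r' i + r' d, 4 := v), M')"
      unfolding wp_def by fastforce
    let ?r = "r'(i := r' i + r' d)"
    let ?r' = "?r(4 := ?r b - ?r i)"
    have e: "exec (c ;; Add i i d ;; Sub 4 b i) (r, M) (t + (1 + 1)) (?r', M')"
      by (rule exec.Seq[OF c exec.Seq[OF exec.Add exec.Sub]])
    have "\<exists>u \<sigma>'. exec (While 4 (c ;; Add i i d ;; Sub 4 b i)) (?r', M') u \<sigma>' \<and>
      u \<le> (K - Suc k) * (poly (time_poly c) n + 3) + 1 \<and> Q \<sigma>'"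
      by (rule Suc.hyps) (use Suc.hyps(2) kK I i in auto)
    then obtain u \<sigma>' where w: "exec (While 4 (c ;; Add i i d ;; Sub 4 b i)) (?r', M') u \<sigma>'"
      and u: "u \<le> (K - Suc k) * (poly (time_poly c) n + 3) + 1" and Q: "Q \<sigma>'" by blast
    have "K - k = Suc (K - Suc k)" using kK by simp
    then have "t + (1 + 1) + u + 1 \<le> (K - k) * (poly (time_poly c) n + 3) + 1"
      using t u by simp
    then show ?case using exec.WhileTrue[OF nz e w] Q by blast
  qed
  have "wp n (While 4 (c ;; Add i i d ;; Sub 4 b i)) Q (r(4 := r b - r i), M)"
  proof -
    obtain t \<sigma>' where 1: "exec (While 4 (c ;; Add i i d ;; Sub 4 b i)) (r(4 := r b - r i), M) t \<sigma>'"
      "t \<le> (K - k) * (poly (time_poly c) n + 3) + 1" "Q \<sigma>'"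
      using key[OF init k(1), of "r b - r i"] i by auto
    have "(K - k) * (poly (time_poly c) n + 3) \<le> n * (poly (time_poly c) n + 3)"
      using k(2) by (rule mult_le_mono1)
    with 1 show ?thesis unfolding wp_def by (fastforce simp: algebra_simps)
  qed
  then show ?thesis unfolding For_def by (intro wp_Seq wp_atomic)
qed

lemmas wp_rules = wp_Seq wp_atomic wp_Cond


section \<open>Representability as a set cover problem\<close>

definition pairs :: "bool list \<Rightarrow> (nat \<times> nat) set" where
  "pairs w = {(i, j). i < length w \<and> j < length w \<and> w ! i \<and> \<not> w ! j}"

lemma finite_pairs [simp]: "finite (pairs w)"
  by (rule finite_subset[of _ "{..<length w} \<times> {..<length w}"]) (auto simp: pairs_def)

lemma length_eval:
  "(\<And>w. w \<in> operands f \<Longrightarrow> length w = m) \<Longrightarrow> length (eval f) = m"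
  by (induction f) auto

text \<open>The implication from bit \<open>i\<close> to bit \<open>j\<close> survives both
  \<open>And\<close> and \<open>Or\<close>; a negation would reverse it. Equal lengths keep
  \<open>map2\<close> from truncating.\<close>

lemma eval_mono:
  assumes "\<And>w. w \<in> operands f \<Longrightarrow> length w = m" and "i < m" "j < m"
    and "\<And>w. w \<in> operands f \<Longrightarrow> w ! i \<Longrightarrow> w ! j"
  shows "eval f ! i \<Longrightarrow> eval f ! j"
  using assms by (induction f) (auto simp: length_eval)

lemma pairs_subset_if_representable:
  assumes "representable C s" and len: "\<And>w. w \<in> C \<Longrightarrow> length w = m"
  shows "pairs s \<subseteq> \<Union> (pairs ` C)"
proof clarify
  fix i j assume ij: "(i, j) \<in> pairs s"
  from assms(1) obtain f where f: "operands f \<subseteq> C" "eval f = s"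
    by (auto simp: representable_def)
  have lf: "\<And>w. w \<in> operands f \<Longrightarrow> length w = m" using f len by auto
  with f have "length s = m" using length_eval by blast
  with ij have "i < m" "j < m" "s ! i" "\<not> s ! j" by (auto simp: pairs_def)
  with eval_mono[of f m i j] lf f obtain w where "w \<in> operands f" "w ! i" "\<not> w ! j"
    by blast
  with f lf \<open>i < m\<close> \<open>j < m\<close> show "(i, j) \<in> \<Union> (pairs ` C)"
    by (auto simp: pairs_def intro!: bexI[of _ w])
qed

lemma representable_self: "w \<in> C \<Longrightarrow> representable C w"
  unfolding representable_def by (rule exI[of _ "Operand w"]) auto

lemma representable_map2:
  assumes "representable C x" "representable C y"
  shows "representable C (map2 (\<and>) x y)" "representable C (map2 (\<or>) x y)"
proof -
  from assms obtain f g where *: "operands f \<subseteq> C" "eval f = x" "operands g \<subseteq> C" "eval g = y"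
    by (auto simp: representable_def)
  show "representable C (map2 (\<and>) x y)"
    unfolding representable_def by (rule exI[of _ "And f g"]) (simp add: *)
  show "representable C (map2 (\<or>) x y)"
    unfolding representable_def by (rule exI[of _ "Or f g"]) (simp add: *)
qed

text \<open>No formula denotes the empty conjunction, so the induction starts at singletons.\<close>

lemma representable_all:
  assumes "finite X" "X \<noteq> {}" "\<And>x. x \<in> X \<Longrightarrow> length x = m \<and> representable C x"
  shows "representable C (map (\<lambda>i. \<forall>x\<in>X. x ! i) [0..<m])"
  using assms
proof (induction rule: finite_ne_induct)
  case (singleton x)
  then have "map (\<lambda>i. \<forall>x\<in>{x}. x ! i) [0..<m] = x" by (auto intro: nth_equalityI)
  with singleton show ?case by simp
next
  case (insert x F)
  then have "map (\<lambda>i. \<forall>x\<in>insert x F. x ! i) [0..<m] =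
      map2 (\<and>) x (map (\<lambda>i. \<forall>x\<in>F. x ! i) [0..<m])"
    by (auto intro: nth_equalityI)
  with insert show ?case by (auto simp del: map_eq_conv intro: representable_map2)
qed

lemma representable_ex:
  assumes "finite X" "X \<noteq> {}" "\<And>x. x \<in> X \<Longrightarrow> length x = m \<and> representable C x"
  shows "representable C (map (\<lambda>i. \<exists>x\<in>X. x ! i) [0..<m])"
  using assms
proof (induction rule: finite_ne_induct)
  case (singleton x)
  then have "map (\<lambda>i. \<exists>x\<in>{x}. x ! i) [0..<m] = x" by (auto intro: nth_equalityI)
  with singleton show ?case by simp
next
  case (insert x F)
  then have "map (\<lambda>i. \<exists>x\<in>insert x F. x ! i) [0..<m] =
      map2 (\<or>) x (map (\<lambda>i. \<exists>x\<in>F. x ! i) [0..<m])"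
    by (auto intro: nth_equalityI)
  with insert show ?case by (auto simp del: map_eq_conv intro: representable_map2)
qed

lemma nonconstant_positions:
  assumes "length s = m" "s \<notin> {replicate m False, replicate m True}"
  obtains i j where "i < m" "s ! i" "j < m" "\<not> s ! j"
proof -
  have "\<exists>i<m. s ! i" using assms by (auto intro!: nth_equalityI)
  moreover have "\<exists>j<m. \<not> s ! j" using assms by (auto intro!: nth_equalityI)
  ultimately show thesis using that by blast
qed

text \<open>The disjunctive normal form: for every position \<open>i\<close> of a 1 in \<open>s\<close>, take the conjunction of
  all strings that are 1 at \<open>i\<close>.\<close>

lemma representable_if_pairs_subset:
  assumes fin: "finite C" and len: "\<And>w. w \<in> C \<Longrightarrow> length w = m" and s: "length s = m"
    "s \<notin> {replicate m False, replicate m True}" and cov: "pairs s \<subseteq> \<Union> (pairs ` C)"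
  shows "representable C s"
proof -
  \<comment> \<open>The zero at \<open>j0\<close> makes every conjunction \<open>A i\<close>
    nonempty, and the one at \<open>i0\<close> makes the outer disjunction nonempty.\<close>
  from s obtain i0 j0 where i0: "i0 < m" "s ! i0" and j0: "j0 < m" "\<not> s ! j0"
    by (rule nonconstant_positions)
  have sep: "\<exists>w\<in>C. w ! i \<and> \<not> w ! j" if "i < m" "s ! i" "j < m" "\<not> s ! j" for i j
  proof -
    have "(i, j) \<in> pairs s" using that s by (auto simp: pairs_def)
    with cov show ?thesis by (auto simp: pairs_def)
  qed
  define A where "A i = map (\<lambda>j. \<forall>w\<in>{w\<in>C. w ! i}. w ! j) [0..<m]" for i
  have A: "representable C (A i)" if "i < m" "s ! i" for i
    unfolding A_def by (rule representable_all) (use fin len sep[OF that j0] in \<open>auto intro: representable_self\<close>)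
  let ?X = "A ` {i. i < m \<and> s ! i}"
  have "representable C (map (\<lambda>j. \<exists>x\<in>?X. x ! j) [0..<m])"
    by (rule representable_ex) (use A i0 in \<open>auto simp: A_def\<close>)
  also have "map (\<lambda>j. \<exists>x\<in>?X. x ! j) [0..<m] = s"
  proof (rule nth_equalityI)
    fix j assume "j < length (map (\<lambda>j. \<exists>x\<in>?X. x ! j) [0..<m])"
    then have j: "j < m" by simp
    have "(\<exists>x\<in>?X. x ! j) \<longleftrightarrow> (\<exists>i<m. s ! i \<and> (\<forall>w\<in>C. w ! i \<longrightarrow> w ! j))"
      using j by (auto simp: A_def)
    \<comment> \<open>If bit \<open>j\<close> of \<open>s\<close> is 1, take \<open>i = j\<close>;
      if it is 0, \<open>sep\<close> refutes every \<open>i\<close>.\<close>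
    also have "\<dots> \<longleftrightarrow> s ! j" using sep j by blast
    finally show "map (\<lambda>j. \<exists>x\<in>?X. x ! j) [0..<m] ! j = s ! j" using j by simp
  qed (use s in simp)
  finally show ?thesis .
qed

text \<open>The pairs are the product of the positions of ones and of zeros, so this is the
  inequality of arithmetic and geometric means.\<close>

lemma card_pairs_le: "real (card (pairs s)) \<le> (real (length s) / 2)\<^sup>2"
proof -
  let ?I = "{i. i < length s \<and> s ! i}" and ?J = "{j. j < length s \<and> \<not> s ! j}"
  have "pairs s = ?I \<times> ?J" by (auto simp: pairs_def)
  then have 1: "card (pairs s) = card ?I * card ?J" by (simp add: card_cartesian_product)
  have "?I \<union> ?J = {..<length s}" "?I \<inter> ?J = {}" by auto
  then have "card ?I + card ?J = length s" by (metis card_Un_disjoint card_lessThan finite_Un finite_lessThan)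
  then have 2: "real (length s) = real (card ?I) + real (card ?J)" by linarith
  have "0 \<le> (real (card ?I) - real (card ?J))\<^sup>2" by simp
  then show ?thesis unfolding 1 2 by (simp add: power2_eq_square field_simps)
qed


section \<open>Greedy set cover\<close>

definition uncovered :: "'a set \<Rightarrow> ('i \<Rightarrow> 'a set) \<Rightarrow> 'i set \<Rightarrow> 'a set" where
  "uncovered U S F = U - (\<Union>l\<in>F. S l)"

text \<open>A relation leaves ties open, so that whatever best row the machine picks fits. The
  positive gain makes every step count.\<close>

inductive greedy :: "'a set \<Rightarrow> ('i \<Rightarrow> 'a set) \<Rightarrow> 'i set \<Rightarrow> 'i set \<Rightarrow> bool" for U S X where
  empty: "greedy U S X {}"
| insert: "greedy U S X F \<Longrightarrow> q \<in> X \<Longrightarrow> S q \<inter> uncovered U S F \<noteq> {}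
    \<Longrightarrow> (\<And>l. l \<in> X \<Longrightarrow> card (S l \<inter> uncovered U S F) \<le> card (S q \<inter> uncovered U S F))
    \<Longrightarrow> greedy U S X (insert q F)"

text \<open>An upper bound for the number of greedy steps that cover \<open>u\<close> elements when \<open>k\<close> sets suffice:
  the integral of \<open>min 1 (k / x)\<close> over \<open>{0..u}\<close>, where every step covers at least one element
  and a fraction \<open>1 / k\<close> of the uncovered ones.\<close>

definition potential :: "nat \<Rightarrow> nat \<Rightarrow> real" where
  "potential k u = (if u \<le> k then real u else real k * (1 + ln (real u / real k)))"

lemma potential_nonneg: "0 \<le> potential k u"
  by (cases "k = 0") (auto simp: potential_def)

text \<open>If \<open>u > k\<close>, the integrand is at least \<open>k / u\<close> on all of
  \<open>{0..u}\<close>, so its last stretch of length \<open>d\<close> contributes at least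
  \<open>k * d / u\<close>, which is at least 1. If \<open>u \<le> k\<close>, the integrand is 1 and
  \<open>d\<close> is at least 1. The tangent bound \<open>ln_ge\<close> stands in for
  integration.\<close>

lemma potential_decrease:
  assumes "0 < k" "0 < d" "d \<le> u" "u \<le> k * d"
  shows "1 + potential k (u - d) \<le> potential k u"
proof -
  define v where "v = u - d"
  have u: "u = v + d" using assms by (simp add: v_def)
  have uR: "real u = real v + real d" by (simp add: u)
  have dk: "real u \<le> real k * real d" using assms(4) by (metis of_nat_le_iff of_nat_mult)
  have d: "1 \<le> real k * real d / real u" using dk assms by (simp add: field_simps)
  have "1 + potential k v \<le> potential k u"
  proof (cases "u \<le> k")
    case True
    then show ?thesis using assms by (simp add: potential_def u)
  next
    case uk: False
    have nz: "real v + real d \<noteq> 0" using assms by simp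
    have ln_ge: "1 - y / x \<le> ln (x / y)" if "0 < x" "0 < y" for x y :: real
      using ln_le_minus_one[of "y / x"] that by (simp add: ln_div)
    show ?thesis
    proof (cases "v \<le> k")
      \<comment> \<open>Here the stretch straddles \<open>k\<close>. Its flat part gives
        \<open>k - v\<close>, at least \<open>(k - v) * (k / u)\<close>, the rest gives
        \<open>k * ln (u / k)\<close>, at least \<open>k * (1 - k / u)\<close>, and these lower
        bounds add up to \<open>k * d / u\<close>.\<close>
      case True
      have "1 - real k / real u \<le> ln (real u / real k)" by (rule ln_ge) (use uk assms in auto)
      then have "real k * (1 - real k / real u) \<le> real k * ln (real u / real k)"
        by (rule mult_left_mono) simp
      moreover have "(real k - real v) * (real k / real u) \<le> (real k - real v) * 1"
        by (rule mult_left_mono) (use True uk in auto)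
      moreover have "(real k - real v) * (real k / real u) + real k * (1 - real k / real u)
        = real k * (1 - real v / real u)"
        by (simp add: algebra_simps diff_divide_distrib)
      moreover have "real k * (1 - real v / real u) = real k * real d / real u"
        using nz by (simp add: uR field_simps)
      ultimately have "1 \<le> (real k - real v) * 1 + real k * ln (real u / real k)"
        using d by (metis add_mono order.trans)
      then show ?thesis using uk True by (simp add: potential_def algebra_simps)
    next
      case False
      have "1 - real v / real u \<le> ln (real u / real v)" by (rule ln_ge) (use uk False in auto)
      then have "real k * (1 - real v / real u) \<le> real k * ln (real u / real v)"
        by (rule mult_left_mono) simp
      moreover have "real k * (1 - real v / real u) = real k * real d / real u"
        using nz by (simp add: uR field_simps)
      ultimately have "1 \<le> real k * ln (real u / real v)" using d by linarith
      moreover have "ln (real u / real v) = ln (real u / real k) - ln (real v / real k)"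
        using uk False assms by (simp add: ln_div)
      ultimately show ?thesis using uk False by (simp add: potential_def algebra_simps)
    qed
  qed
  then show ?thesis by (simp add: v_def)
qed

lemma greedy_finite: "greedy U S X F \<Longrightarrow> finite F \<and> F \<subseteq> X"
  by (induction rule: greedy.induct) auto

text \<open>The sets of \<open>G\<close> together cover whatever is left, so by averaging the best
  set covers at least a fraction \<open>1 / card G\<close> of it. Each greedy step is then paid for
  by a drop of the potential.\<close>

lemma greedy_bound:
  assumes "greedy U S X F" and "finite U" "finite G" "G \<subseteq> X" "U \<subseteq> (\<Union>l\<in>G. S l)" "G \<noteq> {}"
  shows "real (card F) + potential (card G) (card (uncovered U S F)) \<le> potential (card G) (card U)"
  using assms(1)
proof induction
  case empty
  then show ?case by (simp add: uncovered_def)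
next
  case (insert F q)
  let ?V = "uncovered U S F" and ?D = "S q \<inter> uncovered U S F"
  have fin: "finite ?V" using assms by (simp add: uncovered_def)
  have "?V = (\<Union>l\<in>G. S l \<inter> ?V)" using assms by (auto simp: uncovered_def)
  then have "card ?V \<le> (\<Sum>l\<in>G. card (S l \<inter> ?V))"
    using card_UN_le[OF \<open>finite G\<close>, of "\<lambda>l. S l \<inter> ?V"] by simp
  also have "\<dots> \<le> (\<Sum>l\<in>G. card ?D)" by (rule sum_mono) (use insert assms in auto)
  finally have "card ?V \<le> card G * card ?D" by simp
  moreover have "0 < card ?D" using insert fin by (simp add: card_gt_0_iff)
  moreover have "card ?D \<le> card ?V" using fin by (intro card_mono) auto
  moreover have "0 < card G" using assms by (simp add: card_gt_0_iff)
  ultimately have "1 + potential (card G) (card ?V - card ?D) \<le> potential (card G) (card ?V)"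
    by (intro potential_decrease)
  moreover have "uncovered U S (insert q F) = ?V - ?D" by (auto simp: uncovered_def)
  moreover have "card (?V - ?D) = card ?V - card ?D" using fin by (intro card_Diff_subset) auto
  moreover have "card (insert q F) \<le> card F + 1" by (simp add: card_insert_le_m1 card_insert_if greedy_finite[OF insert.hyps(1)])
  ultimately show ?case using insert.IH by simp
qed

text \<open>All that the ratio analysis asks of the program. Guarding the clauses by
  \<open>card F\<close> lets the results of the exhaustive search and of the greedy loop meet one
  specification.\<close>

definition near_optimal :: "'a set \<Rightarrow> ('i \<Rightarrow> 'a set) \<Rightarrow> 'i set \<Rightarrow> 'i set \<Rightarrow> bool" where
  "near_optimal U S X F \<longleftrightarrow> F \<subseteq> X \<and> uncovered U S F = {} \<and>
     (card F \<le> 1 \<or> (\<forall>a\<in>X. uncovered U S {a} \<noteq> {})) \<and>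
     (card F \<le> 2 \<or> (\<forall>a\<in>X. \<forall>b\<in>X. uncovered U S {a, b} \<noteq> {}) \<and> greedy U S X F)"

text \<open>Optima 1 and 2 are found exactly. From 3 on, \<open>1 - ln k \<le> 0\<close> absorbs the additive constant
  of the greedy ratio \<open>ln n + 1 - ln k\<close>.\<close>

lemma near_optimal_ratio:
  assumes F: "near_optimal U S X F" and fin: "finite U" "finite G" and "G \<subseteq> X"
    and cov: "uncovered U S G = {}" and "U \<noteq> {}"
  shows "real (card F) \<le> max 1 (ln (real (card U))) * real (card G)"
proof -
  let ?k = "card G" and ?R = "max 1 (ln (real (card U)))"
  have ge: "real ?k \<le> ?R * real ?k" by (metis max.cobounded1 mult_1 mult_right_mono of_nat_0_le_iff)
  have "G \<noteq> {}" using cov \<open>U \<noteq> {}\<close> by (auto simp: uncovered_def)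
  then have "0 < ?k" using fin by (simp add: card_gt_0_iff)
  then consider "?k = 1" | "?k = 2" | "3 \<le> ?k" by linarith
  then show ?thesis
  proof cases
    case 1
    then obtain a where "G = {a}" by (auto simp: card_1_singleton_iff)
    with F cov \<open>G \<subseteq> X\<close> have "card F \<le> 1" by (auto simp: near_optimal_def)
    with 1 ge show ?thesis by linarith
  next
    case 2
    then obtain a b where "G = {a, b}" by (auto simp: card_2_iff)
    with F cov \<open>G \<subseteq> X\<close> have "card F \<le> 2" by (auto simp: near_optimal_def)
    with 2 ge show ?thesis by linarith
  next
    case 3
    show ?thesis
    proof (cases "card F \<le> 2")
      case True
      with 3 ge show ?thesis by linarith
    next
      case False
      with F have "greedy U S X F" by (auto simp: near_optimal_def)
      moreover have "U \<subseteq> (\<Union>l\<in>G. S l)" using cov by (auto simp: uncovered_def)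
      ultimately have "real (card F) + potential ?k (card (uncovered U S F)) \<le> potential ?k (card U)"
        using fin \<open>G \<subseteq> X\<close> \<open>G \<noteq> {}\<close> by (intro greedy_bound)
      then have le: "real (card F) \<le> potential ?k (card U)"
        using potential_nonneg[of ?k "card (uncovered U S F)"] by linarith
      show ?thesis
      proof (cases "card U \<le> ?k")
        case True
        with le ge show ?thesis by (simp add: potential_def)
      next
        case False
        have "exp 1 \<le> real ?k" using exp_le 3 by linarith
        then have "1 \<le> ln (real ?k)" using 3 by (simp add: ln_ge_iff)
        then have "1 + ln (real (card U) / real ?k) \<le> ?R" using 3 False by (simp add: ln_div)
        then have "real ?k * (1 + ln (real (card U) / real ?k)) \<le> real ?k * ?R"
          by (rule mult_left_mono) simp
        with le False show ?thesis by (simp add: potential_def mult.commute)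
      qed
    qed
  qed
qed

lemma ratio_le_mrs_ratio:
  assumes "pairs s \<noteq> {}"
  shows "max 1 (ln (real (card (pairs s)))) \<le> mrs_ratio (length s)"
proof -
  have pos: "0 < real (card (pairs s))" using assms by (simp add: card_gt_0_iff)
  have "length s \<noteq> 0" using assms by (auto simp: pairs_def)
  then have "ln ((real (length s) / 2)\<^sup>2) = 2 * ln (real (length s) / 2)"
    by (simp add: ln_realpow)
  moreover have "ln (real (card (pairs s))) \<le> ln ((real (length s) / 2)\<^sup>2)"
    using card_pairs_le[of s] pos by (intro ln_mono) auto
  ultimately show ?thesis by (simp add: mrs_ratio_def)
qed


section \<open>The program\<close>

text \<open>Register 0 holds the input length \<open>L\<close>, 1 the string length \<open>m\<close>, 2 the row length \<open>m + 1\<close> and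
  3 the constant 1. A row is identified by its address, row 0 being \<open>s\<close>. The row at address \<open>a\<close>
  is selected iff cell \<open>L + a\<close> contains 1. Registers 5 and 6 hold a pair of positions \<open>(i, j)\<close>;
  since subtraction truncates, \<open>w\<^sub>i - w\<^sub>j\<close> is 1 iff the row \<open>w\<close> separates the pair.\<close>

definition separates :: "nat \<Rightarrow> nat \<Rightarrow> com" where
  "separates d p = (Add d p 5 ;; Load d d ;; Add 10 p 6 ;; Load 10 10 ;; Sub d d 10)"

text \<open>Register 8 starts as the truncated difference of the two bits of \<open>s\<close>, row 0
  lying at address 0, and every selected row that separates the pair subtracts 1. Truncation keeps
  it at 0 however many do.\<close>

definition test_uncovered :: com where
  "test_uncovered = (Load 8 5 ;; Load 9 6 ;; Sub 8 8 9 ;; Const 7 0 ;;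
     For 7 0 2 (Add 9 0 7 ;; Load 9 9 ;; Cond 9 (separates 9 7 ;; Sub 8 8 9) Skip))"

text \<open>Row 0 separates all pairs, so that its gain is the number of uncovered pairs.\<close>

definition gain :: com where
  "gain = (Const 11 0 ;; Const 5 0 ;; For 5 1 3 (Const 6 0 ;; For 6 1 3
     (test_uncovered ;; Cond 8 (separates 9 12 ;; Add 11 11 9) Skip)))"

text \<open>The string length is not given and is found by scanning \<open>s\<close> for its
  separator: \<open>2 - x\<close> is nonzero as long as the cell \<open>x\<close> holds a
  bit.\<close>

definition setup_registers :: com where
  "setup_registers = (Const 3 1 ;; Const 8 2 ;; Load 4 1 ;; Sub 4 8 4 ;;
     While 4 (Add 1 1 3 ;; Load 4 1 ;; Sub 4 8 4) ;; Add 2 1 3)"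

text \<open>Register 11 is both the flag for an unfinished search and the result of
  \<open>gain\<close> for row 0, which is 0 exactly on success. A failure erases the two selection
  flags again.\<close>

definition try_pair :: com where
  "try_pair = Cond 11
     (Add 9 0 13 ;; Store 9 3 ;; Add 9 0 14 ;; Store 9 3 ;; Const 12 0 ;; gain ;;
      Cond 11 (Const 8 0 ;; Add 9 0 13 ;; Store 9 8 ;; Add 9 0 14 ;; Store 9 8) Skip)
     Skip"

text \<open>Register 11 becomes 0 once a cover is found. Single rows come first, since a pair may cover
  before an optimal single row has been tried.\<close>

definition search_pairs :: com where
  "search_pairs = (Const 11 1 ;;
     Copy 13 2 ;; For 13 0 2 (Copy 14 13 ;; try_pair) ;;
     Copy 13 2 ;; For 13 0 2 (Copy 14 2 ;; For 14 0 2 try_pair))"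

definition find_best :: com where
  "find_best = (Const 15 0 ;; Copy 13 2 ;; For 13 0 2
     (Copy 12 13 ;; gain ;; Sub 4 11 15 ;; Cond 4 (Copy 15 11 ;; Copy 16 13) Skip))"

text \<open>After a successful search register 11 is 0 and the loop is skipped, so no case
  distinction is needed.\<close>

definition greedy_phase :: com where
  "greedy_phase = While 11 (find_best ;; Add 9 0 16 ;; Store 9 3 ;; Const 12 0 ;; gain)"

text \<open>The selected rows are moved to the front in place: at least row 0 is dropped, so the
  destination stays behind the source.\<close>

definition copy_row :: com where
  "copy_row = (Const 5 0 ;; For 5 2 3 (Add 9 13 5 ;; Load 9 9 ;; Store 17 9 ;; Add 17 17 3))"

definition write_output :: com where
  "write_output = (Const 17 0 ;; Copy 13 2 ;;
     For 13 0 2 (Add 9 0 13 ;; Load 9 9 ;; Cond 9 copy_row Skip) ;; Copy 0 17)"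

definition mrs_program :: com where
  "mrs_program = (setup_registers ;; search_pairs ;; greedy_phase ;; write_output)"


section \<open>Correctness of the program\<close>

lemma length_encode:
  "(\<And>x. x \<in> set xs \<Longrightarrow> length x = m) \<Longrightarrow> length (encode xs) = length xs * Suc m"
  by (induction xs) (auto simp: encode_def)

lemma nth_encode:
  assumes "\<And>x. x \<in> set xs \<Longrightarrow> length x = m" "l < length xs" "i \<le> m"
  shows "encode xs ! (l * Suc m + i) = (if i = m then 2 else of_bool (xs ! l ! i))"
  using assms
proof (induction xs arbitrary: l)
  case (Cons x xs)
  have e: "encode (x # xs) = (map of_bool x @ [2]) @ encode xs" by (simp add: encode_def)
  show ?case
  proof (cases l)
    case 0
    then show ?thesis using Cons.prems unfolding e by (auto simp: nth_append)
  next
    case (Suc l')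
    have "length x = m" using Cons.prems by simp
    then have "encode (x # xs) ! (l * Suc m + i) = encode xs ! (l' * Suc m + i)"
      unfolding e by (simp add: nth_append Suc add.assoc)
    then show ?thesis using Cons Suc by auto
  qed
qed simp

text \<open>The machine's view: row 0 is \<open>s\<close>, the others are the given strings.
  Representability appears only as coverability, so the program is verified without mentioning
  formulas.\<close>

locale word_instance =
  fixes xs :: "bool list list" and m :: nat
  assumes len: "\<And>x. x \<in> set xs \<Longrightarrow> length x = m" and nonempty: "xs \<noteq> []"
    and pairs_nonempty: "pairs (xs ! 0) \<noteq> {}"
    and coverable: "pairs (xs ! 0) \<subseteq> (\<Union>l\<in>{1..<length xs}. pairs (xs ! l))"
begin

definition D :: nat where "D = Suc m"

definition L :: nat where "L = length xs * D"

text \<open>The flags lie \<open>D\<close> apart so that the address of a row also locates its flag.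
  All other cells beyond the input hold 0 like an unset flag, so \<open>cell {}\<close> is the
  initial memory.\<close>

definition cell :: "nat set \<Rightarrow> nat \<Rightarrow> nat" where
  "cell F a = (if a < L then encode xs ! a else of_bool (\<exists>l\<in>F. a = L + l * D))"

abbreviation S :: "nat \<Rightarrow> (nat \<times> nat) set" where "S l \<equiv> pairs (xs ! l)"

abbreviation rest :: "nat set \<Rightarrow> (nat \<times> nat) set" where "rest \<equiv> uncovered (S 0) S"

abbreviation X :: "nat set" where "X \<equiv> {1..<length xs}"

lemma length_row: "l < length xs \<Longrightarrow> length (xs ! l) = m"
  using len by auto

lemma row_le_L: "l < length xs \<Longrightarrow> i \<le> m \<Longrightarrow> l * D + i < L"
proof -
  assume "l < length xs" "i \<le> m"
  then have "Suc l * D \<le> L" unfolding L_def by (intro mult_le_mono1) simp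
  with \<open>i \<le> m\<close> show ?thesis by (simp add: D_def)
qed

lemma bounds: "length xs \<le> L" "D \<le> L" "0 < length xs"
proof -
  show "0 < length xs" using nonempty by simp
  then have "1 * D \<le> L" unfolding L_def by (intro mult_le_mono1) (simp add: Suc_le_eq)
  then show "D \<le> L" by simp
qed (simp add: L_def D_def)

lemma cell_bit: "l < length xs \<Longrightarrow> i < m \<Longrightarrow> cell F (l * D + i) = of_bool (xs ! l ! i)"
  using nth_encode[of xs m l i] len row_le_L[of l i] by (simp add: cell_def D_def)

lemma cell_end: "l < length xs \<Longrightarrow> cell F (l * D + m) = 2"
  using nth_encode[of xs m l m] len row_le_L[of l m] by (simp add: cell_def D_def)

lemma cell_flag: "cell F (L + l * D) = of_bool (l \<in> F)"
  by (auto simp: cell_def D_def simp del: mult_Suc_right)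

lemma cell_insert: "(cell F)(L + l * D := 1) = cell (insert l F)"
  by (rule ext) (auto simp: cell_def D_def simp del: mult_Suc_right)

lemma cell_delete: "(cell F)(L + l * D := 0) = cell (F - {l})"
  by (rule ext) (auto simp: cell_def D_def simp del: mult_Suc_right)

lemma cell_separates:
  "l < length xs \<Longrightarrow> i < m \<Longrightarrow> j < m \<Longrightarrow>
    cell F (l * D + i) - cell F (l * D + j) = of_bool ((i, j) \<in> S l)"
  by (simp add: cell_bit pairs_def length_row)

lemma row_mono: "k < length xs \<longleftrightarrow> k * D < L"
  unfolding L_def by (simp add: D_def del: mult_Suc_right)

definition base :: "(nat \<Rightarrow> nat) \<Rightarrow> bool" where
  "base r \<longleftrightarrow> r 0 = L \<and> r 1 = m \<and> r 2 = D \<and> r 3 = 1"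

lemma base_upd [simp]: "x \<notin> {0, 1, 2, 3} \<Longrightarrow> base (r(x := v)) = base r"
  by (simp add: base_def)

lemma base_simps: "base r \<Longrightarrow> r 0 = L" "base r \<Longrightarrow> r (Suc 0) = m" "base r \<Longrightarrow> r 2 = D" "base r \<Longrightarrow> r 3 = Suc 0"
  by (simp_all add: base_def)

section \<open>Coverage test and gain of a row\<close>

lemma rest_Suc: "rest (F \<inter> {..<Suc k}) =
    (if k \<in> F then rest (F \<inter> {..<k}) - S k else rest (F \<inter> {..<k}))"
  by (auto simp: uncovered_def lessThan_Suc)

lemma test_uncovered_correct:
  assumes "base r" "r 5 = i" "r 6 = j" "i < m" "j < m" "F \<subseteq> {..<length xs}"
    and "M = cell F"
  shows "wp L test_uncovered (\<lambda>(r', M'). M' = cell F \<and> r' 8 = of_bool ((i, j) \<in> rest F) \<and>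
    (\<forall>x. x \<notin> {4, 7, 8, 9, 10} \<longrightarrow> r' x = r x)) (r, M)"
proof -
  let ?I = "\<lambda>k (r', M'). M' = cell F \<and> r' 7 = k * D \<and>
    r' 8 = of_bool ((i, j) \<in> rest (F \<inter> {..<k})) \<and> (\<forall>x. x \<notin> {4, 7, 8, 9, 10} \<longrightarrow> r' x = r x)"
  show ?thesis
    unfolding test_uncovered_def
    apply (intro wp_rules)
    apply (rule wp_For[where k = 0 and K = "length xs" and I = ?I])
    subgoal using cell_separates[of 0 i j F] assms bounds by (simp add: uncovered_def)
    subgoal by simp
    subgoal using bounds by simp
    subgoal using assms by (auto simp: row_mono base_def)
    subgoal by simp
    subgoal by simp
    subgoal for k r' M'
      unfolding separates_def
      apply (intro wp_rules)
      using assms cell_separates[of k i j F]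
      apply (auto simp: base_def cell_flag rest_Suc)
      done
    subgoal for r' M' using assms by (auto simp: inf.absorb1)
    done
qed

text \<open>What two nested loops have counted of \<open>G\<close> on reaching \<open>(i, j)\<close>
  in lexicographic order. The end of an inner loop identifies \<open>part G i m\<close> with
  \<open>part G (Suc i) 0\<close>.\<close>

definition part :: "(nat \<times> nat) set \<Rightarrow> nat \<Rightarrow> nat \<Rightarrow> (nat \<times> nat) set" where
  "part G i j = {(a, b) \<in> G. a < i \<or> a = i \<and> b < j}"

lemma card_part_Suc:
  assumes "finite G"
  shows "card (part G i (Suc j)) = card (part G i j) + of_bool ((i, j) \<in> G)"
proof -
  have "part G i (Suc j) = (if (i, j) \<in> G then insert (i, j) (part G i j) else part G i j)"
    by (auto simp: part_def less_Suc_eq)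
  moreover have "finite (part G i j)" using assms by (rule finite_subset[rotated]) (auto simp: part_def)
  moreover have "(i, j) \<notin> part G i j" by (simp add: part_def)
  ultimately show ?thesis by simp
qed

lemma pairs_less: "l < length xs \<Longrightarrow> S l \<subseteq> {..<m} \<times> {..<m}"
  using length_row by (auto simp: pairs_def)

lemma gain_row_correct:
  assumes "base r" "r 12 = l * D" "l < length xs" "F \<subseteq> {..<length xs}" "M = cell F"
    and "r 5 = i" "i < m" and "r 11 = card (part (S l \<inter> rest F) i 0)"
  shows "wp L (Const 6 0 ;; For 6 1 3
      (test_uncovered ;; Cond 8 (separates 9 12 ;; Add 11 11 9) Skip))
    (\<lambda>(r', M'). M' = cell F \<and> r' 11 = card (part (S l \<inter> rest F) (Suc i) 0) \<and>
      (\<forall>x. x \<notin> {4, 6, 7, 8, 9, 10, 11} \<longrightarrow> r' x = r x)) (r, M)"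
proof -
  let ?G = "S l \<inter> rest F"
  let ?I = "\<lambda>j (r', M'). M' = cell F \<and> r' 6 = j \<and> r' 11 = card (part ?G i j) \<and>
      (\<forall>x. x \<notin> {4, 6, 7, 8, 9, 10, 11} \<longrightarrow> r' x = r x)"
  have last: "part ?G i m = part ?G (Suc i) 0"
    using pairs_less[OF assms(3)] by (auto simp: part_def less_Suc_eq)
  show ?thesis
    apply (intro wp_Seq wp_atomic)
    apply (rule wp_For[where k = 0 and K = m and I = ?I])
    subgoal using assms by simp
    subgoal by simp
    subgoal using bounds by (simp add: D_def)
    subgoal using assms by (auto simp: base_def)
    subgoal by simp
    subgoal by simp
    subgoal for j r' M'
      apply (intro wp_Seq)
      apply (rule wp_mono)
       apply (rule test_uncovered_correct[where i = i and j = j and F = F])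
              apply (use assms in \<open>simp_all add: base_def\<close>)
      apply (clarify, unfold separates_def)
      apply (intro wp_rules)
      using cell_separates[of l i j F]
      apply (auto simp: card_part_Suc)
      done
    subgoal using last by simp
    done
qed

lemma gain_correct:
  assumes "base r" "r 12 = l * D" "l < length xs" "F \<subseteq> {..<length xs}" "M = cell F"
  shows "wp L gain (\<lambda>(r', M'). M' = cell F \<and> r' 11 = card (S l \<inter> rest F) \<and>
    base r' \<and> (\<forall>x. x \<notin> {4..11} \<longrightarrow> r' x = r x)) (r, M)"
proof -
  let ?G = "S l \<inter> rest F"
  let ?I = "\<lambda>i (r', M'). M' = cell F \<and> r' 5 = i \<and> r' 11 = card (part ?G i 0) \<and>
      (\<forall>x. x \<notin> {4..11} \<longrightarrow> r' x = r x)"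
  have last: "part ?G m 0 = ?G"
    using pairs_less[OF assms(3)] by (auto simp: part_def)
  show ?thesis
    unfolding gain_def
    apply (intro wp_Seq wp_atomic)
    apply (rule wp_For[where k = 0 and K = m and I = ?I])
    subgoal using assms by (simp add: part_def)
    subgoal by simp
    subgoal using bounds by (simp add: D_def)
    subgoal using assms by (auto simp: base_def)
    subgoal by simp
    subgoal by simp
    subgoal for i r' M'
      apply (rule wp_mono)
       apply (rule gain_row_correct[where l = l and i = i and F = F])
              apply (use assms in \<open>auto simp: base_def\<close>)
      done
    subgoal using last assms by (simp add: base_def)
    done
qed

section \<open>Finding the string length\<close>

lemma setup_correct:
  "wp L setup_registers (\<lambda>(r, M). base r \<and> M = cell {}) (input_state (encode xs))"
proof -
  let ?I = "\<lambda>(r, M). M = cell {} \<and> r 0 = L \<and> r 1 \<le> m \<and> r 3 = 1 \<and> r 8 = 2 \<and> r 4 = 2 - M (r 1)"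
  have init: "input_state (encode xs) = ((\<lambda>_. 0)(0 := L), cell {})"
    using length_encode[of xs m] len by (auto simp: input_state_def cell_def L_def D_def)
  have val: "cell {} i = (if i = m then 2 else of_bool (xs ! 0 ! i))" if "i \<le> m" for i
    using cell_bit[of 0 i "{}"] cell_end[of 0 "{}"] that bounds by auto
  show ?thesis
    unfolding init setup_registers_def
    apply (intro wp_Seq wp_atomic)
    apply (rule wp_While[where I = ?I and V = "\<lambda>(r, M). m - r 1"])
    subgoal by simp
    subgoal using bounds by (simp add: D_def)
    subgoal for \<sigma>
      apply (cases \<sigma>)
      apply simp
      apply (intro wp_Seq wp_atomic)
      apply (auto simp: val split: if_splits)
      done
    subgoal for \<sigma>
      apply (cases \<sigma>)
      apply simp
      apply (intro wp_Seq wp_atomic)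
      apply (auto simp: val base_def D_def of_bool_def split: if_splits)
      done
    done
qed

section \<open>Exhaustive search over one and two rows\<close>

abbreviation good :: "nat set \<Rightarrow> bool" where "good \<equiv> near_optimal (S 0) S X"

text \<open>\<open>T\<close> is the family of candidate covers refuted so far. It matters only while
  no cover has been found.\<close>

definition search :: "nat set set \<Rightarrow> state \<Rightarrow> bool" where
  "search T = (\<lambda>(r, M). base r \<and> (if r 11 = 0 then \<exists>F. M = cell F \<and> good F
     else M = cell {} \<and> (\<forall>G\<in>T. rest G \<noteq> {})))"

lemma finite_rest [simp]: "finite (rest F)"
  by (simp add: uncovered_def)

lemma rest_subset: "S 0 \<inter> rest F = rest F"
  by (auto simp: uncovered_def)

lemma try_pair_correct:
  assumes "search T (r, M)" "r 13 = a * D" "r 14 = b * D" "a \<in> X" "b \<in> X"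
    and singles: "a = b \<or> (\<forall>c\<in>X. {c} \<in> T)"
  shows "wp L try_pair (\<lambda>(r', M'). search (insert {a, b} T) (r', M') \<and> r' 13 = a * D \<and> r' 14 = b * D)
    (r, M)"
proof -
  \<comment> \<open>A cover by two different rows is acceptable only because \<open>singles\<close>
    has put every single row among the refuted candidates.\<close>
  have good: "good {a, b}" if "rest {a, b} = {}" "\<forall>G\<in>T. rest G \<noteq> {}"
    using that assms by (auto simp: near_optimal_def card_insert_if)
  have erase: "(cell {a, b})(L + a * D := 0, L + b * D := 0) = cell {}"
    unfolding cell_delete by (rule arg_cong[of _ _ cell]) auto
  show ?thesis
    unfolding try_pair_def
    apply (intro wp_Cond)
    subgoal
      apply (intro wp_Seq wp_atomic)
      apply (rule wp_mono)
       apply (rule gain_correct[where l = 0 and F = "{a, b}"])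
           apply (use assms bounds in \<open>simp_all add: search_def base_simps cell_insert[unfolded One_nat_def] insert_commute\<close>)
      subgoal for \<sigma>'
        apply (cases \<sigma>')
        apply simp
        apply (intro wp_rules)
         apply (use good in \<open>auto simp: base_simps rest_subset erase\<close>)
        done
      done
    subgoal using assms by (auto simp: search_def intro!: wp_atomic)
    done
qed

lemma search_mono: "search T (r, M) \<Longrightarrow> T' \<subseteq> T \<Longrightarrow> search T' (r, M)"
  by (auto simp: search_def split: if_splits)

lemma search_upd: "x \<notin> {0, 1, 2, 3, 11} \<Longrightarrow> search T (r(x := v), M) = search T (r, M)"
  by (simp add: search_def base_def)

lemma search_pairs_correct:
  assumes "base r" "M = cell {}"
  shows "wp L search_pairs (search {{a, b} |a b. a \<in> X \<and> b \<in> X}) (r, M)"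
proof -
  \<comment> \<open>The candidates refuted at the head of each loop: \<open>T1\<close> in the pass
    over single rows, \<open>T2\<close> in the outer and \<open>T3\<close> in the inner loop over
    pairs. They start at 1 because row 0 is \<open>s\<close>.\<close>
  define T1 where "T1 k = {{c} |c. c \<in> {1..<k}}" for k :: nat
  define T2 where "T2 k = T1 (length xs) \<union> {{a, b} |a b. a \<in> {1..<k} \<and> b \<in> X}" for k
  define T3 where "T3 k j = T2 k \<union> {{k, b} |b. b \<in> {1..<j}}" for k j
  let ?I1 = "\<lambda>k (r, M). search (T1 k) (r, M) \<and> 1 \<le> k \<and> r 13 = k * D"
  let ?I2 = "\<lambda>k (r, M). search (T2 k) (r, M) \<and> 1 \<le> k \<and> r 13 = k * D"
  let ?I3 = "\<lambda>k j (r, M). search (T3 k j) (r, M) \<and> 1 \<le> j \<and> r 14 = j * D \<and> r 13 = k * D"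
  have len1: "1 \<le> length xs" using nonempty by (simp add: Suc_le_eq)
  have T1: "T1 1 = {}" "1 \<le> k \<Longrightarrow> T1 (Suc k) = insert {k} (T1 k)" for k
    by (auto simp: T1_def less_Suc_eq)
  have T3: "T3 k 1 = T2 k" "1 \<le> j \<Longrightarrow> T3 k (Suc j) = insert {k, j} (T3 k j)" for k j
    by (auto simp: T3_def less_Suc_eq)
  have T2: "T2 1 = T1 (length xs)" "1 \<le> k \<Longrightarrow> T2 (Suc k) = T3 k (length xs)" for k
    by (auto simp: T2_def T3_def less_Suc_eq)
  have singles: "c \<in> X \<Longrightarrow> {c} \<in> T3 k j" for c k j
    by (auto simp: T1_def T2_def T3_def)
  have final: "{{a, b} |a b. a \<in> X \<and> b \<in> X} \<subseteq> T2 (length xs)"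
    by (auto simp: T2_def)
  have limit: "search T (r, M) \<Longrightarrow> k * D < r 0 \<longleftrightarrow> k < length xs" for T r M k
    by (auto simp: search_def base_def row_mono)
  have step: "search T (r, M) \<Longrightarrow> r 2 = D" for T r M
    by (auto simp: search_def base_def)
  show ?thesis
    unfolding search_pairs_def
    apply (intro wp_Seq wp_atomic)
    apply (rule wp_For[where k = 1 and K = "length xs" and I = ?I1])
    subgoal using assms by (simp add: search_def base_simps T1[unfolded One_nat_def])
    subgoal using len1 .
    subgoal using bounds by simp
    subgoal by (auto simp: limit)
    subgoal by simp
    subgoal by simp
    subgoal for k r M
      apply (intro wp_Seq wp_atomic)
      apply (rule wp_mono)
       apply (rule try_pair_correct[where a = k and b = k and T = "T1 k"])
            apply (auto simp: singles search_upd T1[unfolded One_nat_def] step)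
      done
    apply (intro wp_Seq wp_atomic)
    apply (rule wp_For[where k = 1 and K = "length xs" and I = ?I2])
    subgoal using len1 by (auto simp: singles search_upd step T2[unfolded One_nat_def] T3[unfolded One_nat_def])
    subgoal using len1 .
    subgoal using bounds by simp
    subgoal by (auto simp: limit)
    subgoal by simp
    subgoal by simp
    subgoal for _ _ k r M
      apply (intro wp_Seq wp_atomic)
      apply (rule wp_For[where k = 1 and K = "length xs" and I = "?I3 k"])
      subgoal by (auto simp: singles search_upd step T2[unfolded One_nat_def] T3[unfolded One_nat_def])
      subgoal using len1 .
      subgoal using bounds by simp
      subgoal by (auto simp: limit)
      subgoal by simp
      subgoal by simp
      subgoal for j r M
        apply (rule wp_mono)
         apply (rule try_pair_correct[where a = k and b = j and T = "T3 k j"])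
              apply (auto simp: singles search_upd T3[unfolded One_nat_def] step)
        done
      subgoal by (auto simp: singles search_upd T2[unfolded One_nat_def] step)
      done
    subgoal by (rule search_mono[OF _ final]) simp
    done
qed

section \<open>The greedy loop\<close>

lemma find_best_correct:
  assumes "base r" "M = cell F" "F \<subseteq> X" "rest F \<noteq> {}"
  shows "wp L find_best (\<lambda>(r', M'). M' = cell F \<and> base r' \<and>
    (\<exists>q\<in>X. r' 16 = q * D \<and> S q \<inter> rest F \<noteq> {} \<and>
      (\<forall>l\<in>X. card (S l \<inter> rest F) \<le> card (S q \<inter> rest F)))) (r, M)"
proof -
  let ?g = "\<lambda>l. card (S l \<inter> rest F)"
  let ?I = "\<lambda>k (r, M). M = cell F \<and> base r \<and> 1 \<le> k \<and> r 13 = k * D \<and> (\<forall>l\<in>{1..<k}. ?g l \<le> r 15) \<and>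
    (r 15 \<noteq> 0 \<longrightarrow> (\<exists>q\<in>X. r 16 = q * D \<and> ?g q = r 15))"
  have F: "F \<subseteq> {..<length xs}" using assms(3) by auto
  \<comment> \<open>An uncovered pair is separated by some row, so the maximal gain exceeds the
    initial 0 and register 16 has really been set.\<close>
  obtain l where l: "l \<in> X" "S l \<inter> rest F \<noteq> {}"
    using assms(4) coverable by (fastforce simp: uncovered_def)
  then have pos: "0 < ?g l" by (simp add: card_gt_0_iff)
  show ?thesis
    unfolding find_best_def
    apply (intro wp_Seq wp_atomic)
    apply (rule wp_For[where k = 1 and K = "length xs" and I = ?I])
    subgoal using assms by (simp add: base_simps)
    subgoal using bounds by (simp add: Suc_le_eq)
    subgoal using bounds by simp
    subgoal by (auto simp: base_simps row_mono)
    subgoal by simp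
    subgoal by simp
    subgoal for k r M
      apply (intro wp_Seq wp_atomic)
      apply (rule wp_mono)
       apply (rule gain_correct[where l = k and F = F])
           apply (use F in \<open>simp_all\<close>)
      subgoal for \<sigma>'
        apply (cases \<sigma>')
        apply simp
        apply (intro wp_rules)
         apply (simp_all add: base_simps atLeastLessThanSuc not_le)
        apply (elim conjE, intro conjI ballI bexI[of _ k])
           apply (blast intro: order.trans less_imp_le)
          apply simp_all
        done
      done
    subgoal for r M
    proof -
      assume "?I (length xs) (r, M)"
      then have I: "M = cell F" "base r" "\<And>l. l \<in> X \<Longrightarrow> ?g l \<le> r 15"
        "r 15 \<noteq> 0 \<Longrightarrow> \<exists>q\<in>X. r 16 = q * D \<and> ?g q = r 15" by auto
      have "0 < r 15" using I(3)[OF l(1)] pos by simp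
      with I(4) obtain q where q: "q \<in> X" "r 16 = q * D" "?g q = r 15" by auto
      with \<open>0 < r 15\<close> have "S q \<inter> rest F \<noteq> {}" by auto
      with q I show ?thesis by auto
    qed
    done
qed

lemma greedy_phase_correct:
  assumes "search {{a, b} |a b. a \<in> X \<and> b \<in> X} (r, M)"
  shows "wp L greedy_phase (\<lambda>(r, M). base r \<and> (\<exists>F. good F \<and> M = cell F)) (r, M)"
proof -
  \<comment> \<open>The first alternative describes a search that succeeded, the second a greedy run
    after one that failed.\<close>
  let ?near = "\<lambda>F. good F \<or> (\<forall>a\<in>X. \<forall>b\<in>X. rest {a, b} \<noteq> {}) \<and> greedy (S 0) S X F"
  let ?I = "\<lambda>(r, M). base r \<and> (\<exists>F. M = cell F \<and> F \<subseteq> X \<and> (r 11 = 0 \<longleftrightarrow> rest F = {}) \<and> ?near F)"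
  \<comment> \<open>The variant must be read off the state, so it counts flags in memory instead of
    using the existentially quantified \<open>F\<close>. Row 0 is never selected, so the truncated
    difference stays positive and strictly decreases.\<close>
  define V :: "state \<Rightarrow> nat" where
    "V = (\<lambda>(r, M). length xs - card {l \<in> X. M (L + l * D) \<noteq> 0})"
  have V: "V (r, cell F) = length xs - card F" if "F \<subseteq> X" for r F
  proof -
    have "{l \<in> X. cell F (L + l * D) \<noteq> 0} = F" using that by (auto simp: cell_flag)
    then show ?thesis unfolding V_def split_conv by simp
  qed
  have card_X: "card F < length xs" if "F \<subseteq> X" for F
  proof -
    have "card F \<le> length xs - 1" using card_mono[OF _ that] by simp
    then show ?thesis using bounds(3) by linarith
  qed
  have finished: "good F" if "rest F = {}" "?near F" for F
  proof (cases "good F")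
    case False
    with that(2) have pairs: "\<forall>a\<in>X. \<forall>b\<in>X. rest {a, b} \<noteq> {}" and gr: "greedy (S 0) S X F"
      by blast+
    have "rest {a} \<noteq> {}" if "a \<in> X" for a
    proof -
      have "rest {a, a} \<noteq> {}" using pairs that by blast
      then show ?thesis by simp
    qed
    with pairs gr that(1) greedy_finite[OF gr] show ?thesis unfolding near_optimal_def by blast
  qed
  have nonempty_rest: "rest {} \<noteq> {}" using pairs_nonempty by (simp add: uncovered_def)
  show ?thesis
    unfolding greedy_phase_def
  proof (rule wp_While[where I = ?I and V = V])
    show "?I (r, M)"
    proof (cases "r 11 = 0")
      case True
      with assms obtain F where "base r" "M = cell F" "good F" by (auto simp: search_def)
      with True show ?thesis by (auto simp: near_optimal_def)
    next
      case False
      with assms have *: "base r \<and> M = cell {} \<and>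
          (\<forall>G\<in>{{a, b} |a b. a \<in> X \<and> b \<in> X}. rest G \<noteq> {})"
        unfolding search_def by (simp only: split_conv if_False) blast
      have "rest {a, b} \<noteq> {}" if "a \<in> X" "b \<in> X" for a b
        by (rule bspec[OF conjunct2[OF conjunct2[OF *]]]) (use that in blast)
      with * False nonempty_rest greedy.empty[of "S 0" S X] show ?thesis by (auto intro!: exI[of _ "{}"])
    qed
    show "V (r, M) \<le> L" using bounds by (simp add: V_def)
  next
    fix \<sigma> assume I: "?I \<sigma>" and nz: "fst \<sigma> 11 \<noteq> 0"
    obtain r M where \<sigma>: "\<sigma> = (r, M)" by (cases \<sigma>)
    from I nz \<sigma> obtain F where F: "base r" "M = cell F" "F \<subseteq> X" "rest F \<noteq> {}" "?near F" by auto
    then have gr: "\<forall>a\<in>X. \<forall>b\<in>X. rest {a, b} \<noteq> {}" "greedy (S 0) S X F"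
      by (auto simp: near_optimal_def)
    show "wp L (find_best ;; Add 9 0 16 ;; Store 9 3 ;; Const 12 0 ;; gain)
        (\<lambda>\<sigma>'. ?I \<sigma>' \<and> V \<sigma>' < V \<sigma>) \<sigma>"
      unfolding \<sigma>
    proof (intro wp_Seq, rule wp_mono[OF find_best_correct[OF F(1-4)]])
      fix \<sigma>' assume a: "case \<sigma>' of (r', M') \<Rightarrow> M' = cell F \<and> base r' \<and>
        (\<exists>q\<in>X. r' 16 = q * D \<and> S q \<inter> rest F \<noteq> {} \<and>
          (\<forall>l\<in>X. card (S l \<inter> rest F) \<le> card (S q \<inter> rest F)))"
      obtain r' M' where \<sigma>': "\<sigma>' = (r', M')" by (cases \<sigma>')
      from a obtain q where q: "M' = cell F" "base r'" "q \<in> X" "r' 16 = q * D"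
        "S q \<inter> rest F \<noteq> {}" "\<And>l. l \<in> X \<Longrightarrow> card (S l \<inter> rest F) \<le> card (S q \<inter> rest F)"
        unfolding \<sigma>' split_conv by blast
      have qF: "q \<notin> F" using q(5) by (auto simp: uncovered_def)
      have sub: "insert q F \<subseteq> X" using q F by simp
      have "finite F" using F(3) by (rule finite_subset) simp
      then have card: "card (insert q F) = Suc (card F)" using qF by simp
      have gr': "greedy (S 0) S X (insert q F)" by (rule greedy.insert[OF gr(2) q(3,5,6)])
      show "wp L (Add 9 0 16 ;; Store 9 3 ;; Const 12 0 ;; gain)
          (\<lambda>\<sigma>'. ?I \<sigma>' \<and> V \<sigma>' < V (r, M)) \<sigma>'"
        unfolding \<sigma>'
        apply (intro wp_Seq wp_atomic)
        apply (rule wp_mono)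
         apply (rule gain_correct[where l = 0 and F = "insert q F"])
             apply (use q sub bounds in \<open>auto simp: base_simps cell_insert[unfolded One_nat_def]\<close>)[5]
        subgoal for \<sigma>''
          using gr(1) gr' sub card card_X[OF F(3)]
          by (cases \<sigma>'') (auto simp: V V[OF F(3)] F(2) rest_subset simp del: insert_subset)
        done
    qed
  next
    fix \<sigma> assume "?I \<sigma>" "fst \<sigma> 11 = 0"
    then show "case \<sigma> of (r, M) \<Rightarrow> base r \<and> (\<exists>F. good F \<and> M = cell F)"
      using finished by (cases \<sigma>) fastforce
  qed
qed

section \<open>In-place output of the selected rows\<close>

definition selection :: "nat set \<Rightarrow> nat \<Rightarrow> bool list list" where
  "selection F k = map ((!) xs) (filter (\<lambda>l. l \<in> F) [1..<k])"

lemma selection_Suc: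
  "1 \<le> k \<Longrightarrow> selection F (Suc k) = selection F k @ (if k \<in> F then [xs ! k] else [])"
  by (simp add: selection_def)

lemma length_selection: "length (selection F k) \<le> k - 1"
  unfolding selection_def using length_filter_le[of "\<lambda>l. l \<in> F" "[1..<k]"] by simp

lemma length_encode_selection:
  "k \<le> length xs \<Longrightarrow> length (encode (selection F k)) = length (selection F k) * D"
  unfolding D_def by (rule length_encode) (auto simp: selection_def intro: len)

lemma row_word:
  assumes "l < length xs"
  shows "map (\<lambda>i. cell F (l * D + i)) [0..<D] = encode [xs ! l]"
proof -
  have "map (\<lambda>i. cell F (l * D + i)) [0..<m] = map of_bool (xs ! l)"
    using assms by (auto intro!: nth_equalityI simp: length_row cell_bit)
  then show ?thesis using assms by (simp add: D_def encode_def cell_end[unfolded D_def] del: mult_Suc_right)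
qed

lemma copy_row_correct:
  assumes "base r" "r 13 = k * D" "r 17 + D \<le> k * D" "k < length xs"
    and M: "\<And>a. r 17 \<le> a \<Longrightarrow> M a = cell F a"
  shows "wp L copy_row (\<lambda>(r', M'). base r' \<and> r' 13 = k * D \<and> r' 17 = r 17 + D \<and>
    (\<forall>a. r 17 + D \<le> a \<longrightarrow> M' a = cell F a) \<and>
    map M' [0..<r 17 + D] = map M [0..<r 17] @ encode [xs ! k]) (r, M)"
proof -
  define N where "N j = (\<lambda>a. if r 17 \<le> a \<and> a < r 17 + j then cell F (k * D + (a - r 17)) else M a)"
    for j
  let ?I = "\<lambda>j (r', M'). base r' \<and> r' 5 = j \<and> r' 13 = k * D \<and> r' 17 = r 17 + j \<and> M' = N j"
  \<comment> \<open>The destination ends at or before the start of row \<open>k\<close>, so the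
    source cell has not been overwritten.\<close>
  have step: "(N j)(r 17 + j := N j (k * D + j)) = N (Suc j)" if "j < D" for j
    using that assms by (auto simp: fun_eq_iff N_def)
  have final: "map (N D) [0..<r 17 + D] = map M [0..<r 17] @ encode [xs ! k]"
    unfolding row_word[OF assms(4), symmetric, of F]
    by (rule nth_equalityI) (auto simp: nth_append N_def)
  show ?thesis
    unfolding copy_row_def
    apply (intro wp_Seq wp_atomic)
    apply (rule wp_For[where k = 0 and K = D and I = ?I])
    subgoal using assms by (auto simp: fun_eq_iff N_def)
    subgoal by simp
    subgoal using bounds by simp
    subgoal by (auto simp: base_simps)
    subgoal by simp
    subgoal by simp
    subgoal for j r' M'
      apply (intro wp_Seq wp_atomic)
      apply (simp only: split_conv)
      using step[of j]
      apply (simp add: base_simps)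
      done
    subgoal using final M by (auto simp: N_def)
    done
qed

lemma write_output_correct:
  assumes "base r" "M = cell F"
  shows "wp L write_output (\<lambda>\<sigma>. output_word \<sigma> = encode (selection F (length xs))) (r, M)"
proof -
  let ?I = "\<lambda>k (r, M). base r \<and> 1 \<le> k \<and> r 13 = k * D \<and> r 17 = length (encode (selection F k)) \<and>
    map M [0..<r 17] = encode (selection F k) \<and> (\<forall>a. r 17 \<le> a \<longrightarrow> M a = cell F a)"
  \<comment> \<open>Before row \<open>k\<close> at most \<open>k - 1\<close> rows were selected,
    since row 0 is none of them. This leaves the space of one row between the output and its
    source.\<close>
  have room: "length (encode (selection F k)) + D \<le> k * D" if "1 \<le> k" "k \<le> length xs" for k
  proof -
    have "Suc (length (selection F k)) * D \<le> k * D"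
      using length_selection[of F k] that by (intro mult_le_mono1) simp
    then show ?thesis using that by (simp add: length_encode_selection)
  qed
  \<comment> \<open>The flag of row \<open>k\<close> lies beyond the output and is therefore still
    intact when it is read.\<close>
  have flag: "length (encode (selection F k)) \<le> L + k * D" if "1 \<le> k" "k \<le> length xs" for k
    using room[OF that] by simp
  have app: "encode (ys @ zs) = encode ys @ encode zs" for ys zs
    by (simp add: encode_def)
  have len_row: "length (encode [xs ! k]) = D" if "k < length xs" for k
    unfolding row_word[OF that, of "{}", symmetric] by simp
  show ?thesis
    unfolding write_output_def
    apply (intro wp_Seq wp_atomic)
    apply (rule wp_For[where k = 1 and K = "length xs" and I = ?I])
    subgoal using assms by (simp add: base_simps selection_def encode_def)
    subgoal using bounds by (simp add: Suc_le_eq)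
    subgoal using bounds by simp
    subgoal by (auto simp: base_simps row_mono)
    subgoal by simp
    subgoal by simp
    subgoal for k r M
      apply (intro wp_Seq wp_atomic)
      apply (intro wp_Cond)
      subgoal
        apply (rule wp_mono)
         apply (rule copy_row_correct[where k = k and F = F])
             apply (use room[of k] in simp_all)
        apply (use flag[of k] in \<open>auto simp: base_simps cell_flag selection_Suc app len_row split: if_splits\<close>)
        done
      subgoal
        apply (rule wp_atomic)
        apply (use flag[of k] in \<open>auto simp: base_simps cell_flag selection_Suc app len_row split: if_splits\<close>)
        done
      done
    subgoal for r M
      by (intro wp_atomic) (auto simp: output_word_def)
    done
qed

lemma mrs_program_correct:
  "wp L mrs_program (\<lambda>\<sigma>. \<exists>F. good F \<and> output_word \<sigma> = encode (selection F (length xs)))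
    (input_state (encode xs))"
proof -
  let ?Q = "\<lambda>\<sigma>. \<exists>F. good F \<and> output_word \<sigma> = encode (selection F (length xs))"
  have 1: "wp L write_output ?Q \<sigma>" if "case \<sigma> of (r, M) \<Rightarrow> base r \<and> (\<exists>F. good F \<and> M = cell F)" for \<sigma>
  proof -
    obtain r M where \<sigma>: "\<sigma> = (r, M)" by (cases \<sigma>)
    with that obtain F where F: "base r" "good F" "M = cell F" by auto
    show ?thesis unfolding \<sigma> by (rule wp_mono[OF write_output_correct[OF F(1,3)]]) (use F(2) in blast)
  qed
  have 2: "wp L (greedy_phase ;; write_output) ?Q \<sigma>"
    if "search {{a, b} |a b. a \<in> X \<and> b \<in> X} \<sigma>" for \<sigma>
    using that by (cases \<sigma>, hypsubst) (rule wp_Seq[OF wp_mono[OF greedy_phase_correct 1]])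
  have 3: "wp L (search_pairs ;; greedy_phase ;; write_output) ?Q \<sigma>"
    if "case \<sigma> of (r, M) \<Rightarrow> base r \<and> M = cell {}" for \<sigma>
  proof -
    obtain r M where \<sigma>: "\<sigma> = (r, M)" by (cases \<sigma>)
    show ?thesis unfolding \<sigma> by (rule wp_Seq[OF wp_mono[OF search_pairs_correct 2]]) (use that \<sigma> in auto)
  qed
  show ?thesis
    unfolding mrs_program_def by (rule wp_Seq[OF wp_mono[OF setup_correct 3]])
qed

end


section \<open>From row indices back to sets of strings\<close>

lemma selection_solves:
  assumes inst: "mrs_instance m W s" and nonconst: "s \<notin> {replicate m False, replicate m True}"
    and ws: "enumerates ws W" and W: "word_instance (s # ws) m"
    and F: "near_optimal (pairs s) (\<lambda>l. pairs ((s # ws) ! l)) {1..<length (s # ws)} F"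
  defines "cs \<equiv> word_instance.selection (s # ws) F (length (s # ws))"
  shows "distinct cs" "set cs \<subseteq> W" "representable (set cs) s"
    and "real (card (set cs)) \<le> mrs_ratio m * real (mrs_opt W s)"
proof -
  let ?xs = "s # ws" and ?X = "{1..<length (s # ws)}"
  interpret word_instance ?xs m by (rule W)
  have fin: "finite W" and len_W: "\<And>w. w \<in> W \<Longrightarrow> length w = m" and len_s: "length s = m"
    and repr: "representable W s"
    using inst by (auto simp: mrs_instance_def)
  have dist: "distinct ws" and set_ws: "set ws = W" using ws by (auto simp: enumerates_def)
  \<comment> \<open>Index 0 is excluded from \<open>?X\<close>, which matters here because
    \<open>s\<close> may itself occur in \<open>ws\<close>.\<close>
  have inj: "inj_on ((!) ?xs) ?X"
    using dist by (auto simp: inj_on_def nth_Cons' nth_eq_iff_index_eq)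
  have rows: "(!) ?xs ` ?X = W"
  proof -
    have "?X = Suc ` {0..<length ws}" by simp
    then have "(!) ?xs ` ?X = (!) ws ` {0..<length ws}" by (simp only: image_image nth_Cons_Suc)
    also have "\<dots> = W" using nth_image[of "length ws" ws] set_ws by simp
    finally show ?thesis .
  qed
  have FX: "F \<subseteq> ?X" and F_cov: "uncovered (pairs s) (\<lambda>l. pairs (?xs ! l)) F = {}"
    using F by (auto simp: near_optimal_def)
  have set_cs: "set cs = (!) ?xs ` F"
    using FX by (fastforce simp: cs_def selection_def)
  show "distinct cs"
    unfolding cs_def selection_def
    by (simp add: distinct_map) (rule inj_on_subset[OF inj], auto)
  show sub: "set cs \<subseteq> W" unfolding set_cs rows[symmetric] using FX by (rule image_mono)
  show "representable (set cs) s"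
  proof (rule representable_if_pairs_subset[OF _ _ len_s nonconst])
    show "pairs s \<subseteq> \<Union> (pairs ` set cs)"
      using F_cov by (auto simp: set_cs uncovered_def)
  qed (use sub len_W in auto)
  let ?A = "{C. C \<subseteq> W \<and> representable C s}"
  have "mrs_opt W s \<in> card ` ?A"
    unfolding mrs_opt_def by (rule Min_in) (use fin repr in auto)
  then obtain C where C: "C \<subseteq> W" "representable C s" "card C = mrs_opt W s" by auto
  \<comment> \<open>The optimal solution as a set of row indices. By injectivity it has the same
    cardinality, so it can serve as the cover to compare \<open>F\<close> with.\<close>
  define G where "G = {l \<in> ?X. ?xs ! l \<in> C}"
  have GX: "G \<subseteq> ?X" by (auto simp: G_def)
  have image_G: "(!) ?xs ` G = C" using C(1) rows by (auto simp: G_def)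
  have card_G: "card G = mrs_opt W s"
    using card_image[OF inj_on_subset[OF inj GX]] C(3) by (simp add: image_G)
  have "pairs s \<subseteq> \<Union> (pairs ` C)"
    by (rule pairs_subset_if_representable[OF C(2)]) (use C(1) len_W in blast)
  then have "uncovered (pairs s) (\<lambda>l. pairs (?xs ! l)) G = {}"
    unfolding image_G[symmetric] by (auto simp: uncovered_def)
  then have "real (card F) \<le> max 1 (ln (real (card (pairs s)))) * real (card G)"
    by (intro near_optimal_ratio[OF F]) (use GX pairs_nonempty finite_subset[OF GX] in auto)
  also have "\<dots> \<le> mrs_ratio m * real (card G)"
    using ratio_le_mrs_ratio[of s] pairs_nonempty len_s by (intro mult_right_mono) auto
  finally have "real (card F) \<le> mrs_ratio m * real (mrs_opt W s)" by (simp add: card_G)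
  moreover have "card (set cs) \<le> card F"
    unfolding set_cs by (rule card_image_le) (use FX finite_subset in blast)
  ultimately show "real (card (set cs)) \<le> mrs_ratio m * real (mrs_opt W s)" by linarith
qed

lemma word_instance_if_mrs_instance:
  assumes inst: "mrs_instance m W s" and "s \<notin> {replicate m False, replicate m True}"
    and "enumerates ws W"
  shows "word_instance (s # ws) m"
proof
  have len: "\<And>w. w \<in> W \<Longrightarrow> length w = m" "length s = m" and repr: "representable W s"
    using inst by (auto simp: mrs_instance_def)
  have W: "set ws = W" using assms(3) by (simp add: enumerates_def)
  show "length x = m" if "x \<in> set (s # ws)" for x using that len W by auto
  obtain i j where "i < m" "s ! i" "j < m" "\<not> s ! j"
    using nonconstant_positions[OF len(2) assms(2)] by blast
  then have "(i, j) \<in> pairs s" using len by (simp add: pairs_def)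
  then show "pairs ((s # ws) ! 0) \<noteq> {}" by auto
  have "pairs s \<subseteq> \<Union> (pairs ` set ws)"
    unfolding W by (rule pairs_subset_if_representable[OF repr len(1)])
  also have "\<dots> \<subseteq> (\<Union>l\<in>{1..<length (s # ws)}. pairs ((s # ws) ! l))"
    by (force simp: in_set_conv_nth)
  finally show "pairs ((s # ws) ! 0) \<subseteq> (\<Union>l\<in>{1..<length (s # ws)}. pairs ((s # ws) ! l))"
    by simp
qed simp

theorem mainTheorem4:
  "\<exists>(A :: com) (p :: nat poly). \<forall>m W s ws.
     mrs_instance m W s \<and> s \<notin> {replicate m False, replicate m True} \<and> enumerates ws W \<longrightarrow>
     (\<exists>t cs C. outputs_in A (encode (s # ws)) t (encode cs) \<and>
        t \<le> poly p (length (encode (s # ws))) \<and>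
        enumerates cs C \<and> C \<subseteq> W \<and> representable C s \<and>
        real (card C) \<le> mrs_ratio m * real (mrs_opt W s))"
proof (intro exI[of _ mrs_program] exI[of _ "time_poly mrs_program"] allI impI, elim conjE)
  fix m W s ws
  assume inst: "mrs_instance m W s" and nonconst: "s \<notin> {replicate m False, replicate m True}"
    and ws: "enumerates ws W"
  let ?xs = "s # ws"
  have W: "word_instance ?xs m" by (rule word_instance_if_mrs_instance[OF inst nonconst ws])
  then interpret word_instance ?xs m .
  \<comment> \<open>The common bound on loop iterations is the input length, which turns
    \<open>time_poly\<close> into a polynomial in the input size.\<close>
  have L: "L = length (encode ?xs)" using length_encode[of ?xs m] len by (simp add: L_def D_def)
  obtain t \<sigma> F where run: "exec mrs_program (input_state (encode ?xs)) t \<sigma>"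
    "t \<le> poly (time_poly mrs_program) (length (encode ?xs))"
    and F: "near_optimal (pairs s) (\<lambda>l. pairs (?xs ! l)) {1..<length ?xs} F"
    and out: "output_word \<sigma> = encode (selection F (length ?xs))"
    using mrs_program_correct unfolding wp_def L nth_Cons_0 by blast
  note sol = selection_solves[OF inst nonconst ws W F]
  let ?cs = "selection F (length ?xs)"
  have "outputs_in mrs_program (encode ?xs) t (encode ?cs)"
    unfolding outputs_in_def using run(1) out by blast
  moreover have "enumerates ?cs (set ?cs)" using sol(1) by (simp add: enumerates_def)
  ultimately show "\<exists>t cs C. outputs_in mrs_program (encode ?xs) t (encode cs) \<and>
      t \<le> poly (time_poly mrs_program) (length (encode ?xs)) \<and>
      enumerates cs C \<and> C \<subseteq> W \<and> representable C s \<and>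
      real (card C) \<le> mrs_ratio m * real (mrs_opt W s)"
    using run(2) sol(2-4) by blast
qed

end
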